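(* Let $\tau=(\mathbb X,\mathbb W)$ and $\tau'=(\mathbb X',\mathbb W')$ be dual admissible pairs. Then the number of bounded domains of the arrangement $A[\tau]$ is equal to the number of bounded domains of the arrangement $A[\tau']$.
   Context: All vector spaces are real. Let $N\ge 3$ and let $k,n$ be natural numbers with $k+n+1=N$, $1\le k,n\le N-2$; $J=\{1,\dots,N+1\}$. Let $\mathbb X=\mathbb R^{N+1}$ with standard basis $e_1,\dots,e_{N+1}$ and let $\mathbb X'$ be its dual space with dual basis $e^1,\dots,e^{N+1}$. Let $\mathbb W\subset\mathbb X$ be a subspace of dimension $k+1$ and $\mathbb W'\subset\mathbb X'$ its annihilator (of dimension $n+1$). Assume that for all $a\ne b$ in $J$ the functions $e^a|_{\mathbb W},e^b|_{\mathbb W}$ are not proportional and the functions $e_a|_{\mathbb W'},e_b|_{\mathbb W'}$ are not proportional. Then $\tau=(\mathbb X,\mathbb W)$ and $\tau'=(\mathbb X',\mathbb W')$ are called dual admissible pairs. Let $A[\tau]=\{H^j:j\in J\}$ be the arrangement of projective hyperplanes $H^j=\{e^j=0\}$ in $\mathbb P(\mathbb W)$, and $A[\tau']=\{H_j:j\in J\}$ the arrangement of projective hyperplanes $H_j=\{e_j=0\}$ in $\mathbb P(\mathbb W')$. A domain of $A[\tau]$ is a connected component of $\mathbb P(\mathbb W)\setminus\bigcup_{j\in J}H^j$; it is bounded with respect to $H^j$ if its closure does not intersect $H^j$. The number of domains bounded with respect to $H^j$ is known not to depend on $j\in J$ and is called the number of bounded domains of $A[\tau]$; taking $j=N+1$,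 it is the number of bounded connected components of the complement of the affine arrangement $\{H^j\setminus H^{N+1}: 1\le j\le N\}$ in the affine space $\mathbb P(\mathbb W)\setminus H^{N+1}$. The same definitions apply to $A[\tau']$. *)

theory Defs
  imports "HOL-Analysis.Analysis"
begin

section \<open>Projective spaces\<close>

definition proj_space :: "'a::real_vector set \<Rightarrow> 'a set set" where
  "proj_space V = {span {v} | v. v \<in> V \<and> v \<noteq> 0}"

text \<open>The quotient topology with respect to the map sending a nonzero vector of \<open>V\<close> to the
  line it spans.\<close>

definition proj_topology :: "'a::real_normed_vector set \<Rightarrow> 'a set topology" where
  "proj_topology V =
     topology (\<lambda>U. U \<subseteq> proj_space V \<and>
                   openin (top_of_set (V - {0})) {v \<in> V - {0}. span {v} \<in> U})"

lemma openin_proj_topology: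
  "openin (proj_topology V) U \<longleftrightarrow>
     U \<subseteq> proj_space V \<and> openin (top_of_set (V - {0})) {v \<in> V - {0}. span {v} \<in> U}"
proof -
  have "istopology (\<lambda>U. U \<subseteq> proj_space V \<and>
           openin (top_of_set (V - {0})) {v \<in> V - {0}. span {v} \<in> U})"
    unfolding istopology_def
  proof (intro conjI allI impI; (elim conjE)?)
    fix S T assume "openin (top_of_set (V - {0})) {v \<in> V - {0}. span {v} \<in> S}"
      and "openin (top_of_set (V - {0})) {v \<in> V - {0}. span {v} \<in> T}"
    then have "openin (top_of_set (V - {0}))
        ({v \<in> V - {0}. span {v} \<in> S} \<inter> {v \<in> V - {0}. span {v} \<in> T})"
      by (rule openin_Int)
    moreover have "{v \<in> V - {0}. span {v} \<in> S} \<inter> {v \<in> V - {0}. span {v} \<in> T} =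
        {v \<in> V - {0}. span {v} \<in> S \<inter> T}"
      by blast
    ultimately show "openin (top_of_set (V - {0})) {v \<in> V - {0}. span {v} \<in> S \<inter> T}"
      by simp
  next
    fix K assume K: "\<forall>S\<in>K. S \<subseteq> proj_space V \<and>
        openin (top_of_set (V - {0})) {v \<in> V - {0}. span {v} \<in> S}"
    have "openin (top_of_set (V - {0})) (\<Union>S\<in>K. {v \<in> V - {0}. span {v} \<in> S})"
      using K by (intro openin_Union) blast
    moreover have "(\<Union>S\<in>K. {v \<in> V - {0}. span {v} \<in> S}) = {v \<in> V - {0}. span {v} \<in> \<Union>K}"
      by blast
    ultimately show "openin (top_of_set (V - {0})) {v \<in> V - {0}. span {v} \<in> \<Union>K}"
      by simp
  qed blast+
  then show ?thesis
    by (simp add: proj_topology_def)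
qed

lemma topspace_proj_topology: "topspace (proj_topology V) = proj_space V"
proof
  have "{v \<in> V - {0}. span {v} \<in> proj_space V} = V - {0}"
    by (auto simp: proj_space_def)
  then have "openin (proj_topology V) (proj_space V)"
    by (simp add: openin_proj_topology)
  then show "proj_space V \<subseteq> topspace (proj_topology V)"
    by (rule openin_subset)
  show "topspace (proj_topology V) \<subseteq> proj_space V"
    using openin_proj_topology openin_topspace by blast
qed

lemma quotient_map_proj_topology:
  "quotient_map (top_of_set (V - {0})) (proj_topology V) (\<lambda>v. span {v})"
  unfolding quotient_map_def topspace_proj_topology
  by (auto simp: proj_space_def openin_proj_topology)

section \<open>Projective arrangements and their domains\<close>

text \<open>An arrangement in the projective space of \<open>V\<close> is given by a family \<open>f\<close> of linear
  functions; its members are the hyperplanes on which the functions vanish.\<close>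

definition hyperplane :: "'a::real_vector set \<Rightarrow> ('j \<Rightarrow> 'a \<Rightarrow> real) \<Rightarrow> 'j \<Rightarrow> 'a set set" where
  "hyperplane V f j = {L \<in> proj_space V. \<forall>x\<in>L. f j x = 0}"

definition domains :: "'a::real_normed_vector set \<Rightarrow> ('j \<Rightarrow> 'a \<Rightarrow> real) \<Rightarrow> 'a set set set" where
  "domains V f =
     connected_components_of
       (subtopology (proj_topology V) (proj_space V - (\<Union>j. hyperplane V f j)))"

definition bounded_domains ::
    "'a::real_normed_vector set \<Rightarrow> ('j \<Rightarrow> 'a \<Rightarrow> real) \<Rightarrow> 'j \<Rightarrow> 'a set set set" where
  "bounded_domains V f j =
     {D \<in> domains V f. proj_topology V closure_of D \<inter> hyperplane V f j = {}}"

definition num_bounded_domains ::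
    "'a::real_normed_vector set \<Rightarrow> ('j \<Rightarrow> 'a \<Rightarrow> real) \<Rightarrow> 'j \<Rightarrow> nat" where
  "num_bounded_domains V f j = card (bounded_domains V f j)"

section \<open>Dual admissible pairs\<close>

text \<open>The ambient space is \<^typ>\<open>real ^ 'j\<close>, with \<open>'j\<close> playing the role of the index set, and its
  dual is the space of (automatically bounded) linear functionals \<^typ>\<open>(real ^ 'j) \<Rightarrow>\<^sub>L real\<close>.\<close>

definition dual_basis :: "'j::finite \<Rightarrow> real ^ 'j \<Rightarrow> real" where
  "dual_basis j x = x $ j"

text \<open>The standard basis vector with index \<open>j\<close>, regarded as a function on the dual space.\<close>

definition std_basis :: "'j::finite \<Rightarrow> ((real ^ 'j) \<Rightarrow>\<^sub>L real) \<Rightarrow> real" where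
  "std_basis j \<phi> = blinfun_apply \<phi> (axis j 1)"

definition annihilator :: "'a::real_normed_vector set \<Rightarrow> ('a \<Rightarrow>\<^sub>L real) set" where
  "annihilator W = {\<phi>. \<forall>w\<in>W. blinfun_apply \<phi> w = 0}"

text \<open>The zero function is proportional to every function.\<close>

definition proportional_on :: "'a set \<Rightarrow> ('a \<Rightarrow> real) \<Rightarrow> ('a \<Rightarrow> real) \<Rightarrow> bool" where
  "proportional_on V f g \<longleftrightarrow>
     (\<exists>c. \<forall>x\<in>V. f x = c * g x) \<or> (\<exists>c. \<forall>x\<in>V. g x = c * f x)"

definition dual_admissible_pairs ::
    "nat \<Rightarrow> (real ^ 'j::finite) set \<Rightarrow> ((real ^ 'j) \<Rightarrow>\<^sub>L real) set \<Rightarrow> bool" where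
  "dual_admissible_pairs k W W' \<longleftrightarrow>
     subspace W \<and> dim W = k + 1 \<and> W' = annihilator W \<and>
     (\<forall>a b. a \<noteq> b \<longrightarrow> \<not> proportional_on W (dual_basis a) (dual_basis b)) \<and>
     (\<forall>a b. a \<noteq> b \<longrightarrow> \<not> proportional_on W' (std_basis a) (std_basis b))"

end

theory Submission
  imports Defs
begin

text \<open>A domain is a sign pattern \<open>S\<close> realised on \<open>W\<close>, up to a global sign. By Gordan's alternative it is
  bounded with respect to \<open>H\<^sup>j\<close> iff, in addition, some vector of the orthogonal complement of \<open>W\<close> has
  the signs \<open>S\<close> off \<open>j\<close>. For two such vectors, orthogonality forces opposite signs at \<open>j\<close>, so
  changing the sign at \<open>j\<close> is a bijection between the domains bounded with respect to \<open>H\<^sup>j\<close> and those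
  of the dual arrangement bounded with respect to \<open>H\<^sub>j\<close>. That the number does not depend on \<open>j\<close>
  follows by deletion and contraction of a third coordinate.\<close>

section \<open>Sign patterns\<close>

definition sign_of :: "'j set \<Rightarrow> 'j \<Rightarrow> real" where
  "sign_of S a = (if a \<in> S then 1 else -1)"

text \<open>A pattern without zeros is encoded by the set \<open>S\<close> of its positive indices.
  Only the indices in \<open>E\<close> are tested, so one \<open>S\<close> can be read on smaller
  ground sets.\<close>

definition agrees :: "'j set \<Rightarrow> 'j set \<Rightarrow> ('j \<Rightarrow> real) \<Rightarrow> bool" where
  "agrees S E g \<longleftrightarrow> (\<forall>a\<in>E. 0 < sign_of S a * g a)"

lemma sign_of_mult_self [simp]: "sign_of S a * sign_of S a = 1"
  by (simp add: sign_of_def)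

lemma sign_of_neq_0 [simp]: "sign_of S a \<noteq> 0"
  by (simp add: sign_of_def)

lemma sign_of_mult_pos_iff:
  "0 < sign_of S a * x \<Longrightarrow> 0 < sign_of S a * y \<longleftrightarrow> 0 < x * y"
  by (auto simp: sign_of_def zero_less_mult_iff split: if_splits)

lemma agrees_nonzero: "agrees S E g \<Longrightarrow> a \<in> E \<Longrightarrow> g a \<noteq> 0"
  unfolding agrees_def by (metis less_irrefl mult_zero_right)

lemma agrees_comb:
  assumes "agrees S E g" and "agrees S E h" and "c > 0" and "d > 0"
  shows "agrees S E (\<lambda>a. c * g a + d * h a)"
  unfolding agrees_def
proof
  fix a assume "a \<in> E"
  with assms have "0 < c * (sign_of S a * g a) + d * (sign_of S a * h a)"
    by (intro add_pos_pos mult_pos_pos[of c] mult_pos_pos[of d]) (auto simp: agrees_def)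
  then show "0 < sign_of S a * (c * g a + d * h a)"
    by (simp add: algebra_simps)
qed

text \<open>Finitely many strict inequalities survive a small move in an arbitrary direction
  \<open>h\<close>.\<close>

lemma agrees_perturb:
  fixes g h :: "'j::finite \<Rightarrow> real"
  assumes "agrees S E g"
  obtains \<epsilon> where "\<epsilon> > 0" and "agrees S E (\<lambda>a. g a + \<epsilon> * h a)"
proof -
  have "\<forall>\<^sub>F \<epsilon> in at_right 0. 0 < sign_of S a * (g a + \<epsilon> * h a)" if "a \<in> E" for a
  proof (rule order_tendstoD)
    show "((\<lambda>\<epsilon>. sign_of S a * (g a + \<epsilon> * h a)) \<longlongrightarrow> sign_of S a * (g a + 0 * h a)) (at_right 0)"
      by (intro tendsto_intros)
    show "0 < sign_of S a * (g a + 0 * h a)"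
      using assms that by (simp add: agrees_def)
  qed
  then have "\<forall>\<^sub>F \<epsilon> in at_right 0. \<forall>a\<in>E. 0 < sign_of S a * (g a + \<epsilon> * h a)"
    by (simp add: eventually_ball_finite)
  moreover have "\<forall>\<^sub>F \<epsilon>::real in at_right 0. \<epsilon> > 0"
    by (simp add: eventually_at_right_less)
  ultimately have "\<forall>\<^sub>F \<epsilon> in at_right 0. \<epsilon> > 0 \<and> agrees S E (\<lambda>a. g a + \<epsilon> * h a)"
    by eventually_elim (simp add: agrees_def)
  then obtain \<epsilon> where "\<epsilon> > 0 \<and> agrees S E (\<lambda>a. g a + \<epsilon> * h a)"
    using eventually_happens'[OF trivial_limit_at_right_real] by blast
  then show ?thesis using that by blast
qed

section \<open>Orthogonal complements and Gordan's alternative\<close>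

lemma orthogonal_compD: "x \<in> W \<Longrightarrow> y \<in> orthogonal_comp W \<Longrightarrow> x \<bullet> y = 0"
  by (simp add: orthogonal_comp_def orthogonal_def)

text \<open>In finite dimension a subspace is its own double complement. The complement of the sum
  \<open>?S\<close> lies in both \<open>U\<close> and \<open>V\<close>; taking complements once more
  gives the decomposition.\<close>

lemma orthogonal_comp_Int:
  fixes U V :: "'a::euclidean_space set"
  assumes "subspace U" and "subspace V"
    and "x \<in> orthogonal_comp (U \<inter> V)"
  obtains y z where "y \<in> orthogonal_comp U" and "z \<in> orthogonal_comp V" and "x = y + z"
proof -
  let ?S = "{y + z | y z. y \<in> orthogonal_comp U \<and> z \<in> orthogonal_comp V}"
  have S: "subspace ?S"
    by (intro subspace_sums subspace_orthogonal_comp)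
  have 0: "0 \<in> orthogonal_comp U" "0 \<in> orthogonal_comp V"
    by (simp_all add: subspace_0 subspace_orthogonal_comp)
  have "orthogonal_comp U \<subseteq> ?S" "orthogonal_comp V \<subseteq> ?S"
    using 0 by force+
  then have "orthogonal_comp ?S \<subseteq> U \<inter> V"
    using orthogonal_comp_anti_mono[of "orthogonal_comp U" ?S]
      orthogonal_comp_anti_mono[of "orthogonal_comp V" ?S]
    by (simp add: orthogonal_comp_self assms(1,2))
  then have "orthogonal_comp (U \<inter> V) \<subseteq> orthogonal_comp (orthogonal_comp ?S)"
    by (rule orthogonal_comp_anti_mono)
  then have "orthogonal_comp (U \<inter> V) \<subseteq> ?S"
    by (simp only: orthogonal_comp_self[OF S])
  then show ?thesis using assms(3) that by blast
qed

text \<open>A hyperplane separates the subspace \<open>W \<inter> F\<close> from the open orthant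
  \<open>A\<close>. Its normal \<open>v\<close> annihilates \<open>W \<inter> F\<close>, hence is a
  sum of \<open>y\<close> orthogonal to \<open>W\<close> and \<open>z\<close> supported on
  \<open>Z\<close>. Moving inside \<open>A\<close> determines the signs of \<open>v\<close>, and
  \<open>y\<close> equals \<open>v\<close> off \<open>Z\<close>.\<close>

lemma gordan:
  fixes W :: "(real ^ 'j::finite) set"
  assumes W: "subspace W" and PZ: "P \<inter> Z = {}"
    and no: "\<not> (\<exists>x\<in>W. (\<forall>a\<in>Z. x $ a = 0) \<and> agrees S P (($) x))"
  obtains y where "y \<in> orthogonal_comp W" and "\<And>a. a \<in> P \<Longrightarrow> 0 \<le> sign_of S a * y $ a"
    and "\<exists>a\<in>P. y $ a \<noteq> 0" and "\<And>a. a \<notin> P \<union> Z \<Longrightarrow> y $ a = 0"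
proof -
  define F :: "(real ^ 'j) set" where "F = {x. \<forall>a\<in>Z. x $ a = 0}"
  define A :: "(real ^ 'j) set" where "A = {x. agrees S P (($) x)}"
  define p :: "real ^ 'j" where "p = (\<chi> a. sign_of S a)"
  have F: "subspace F"
    by (auto simp: F_def subspace_def)
  have L: "subspace (W \<inter> F)"
    using W F by (rule subspace_inter)
  have pA: "p \<in> A"
    by (auto simp: p_def A_def agrees_def)
  have "A = (\<Inter>a\<in>P. {x. (sign_of S a *\<^sub>R axis a 1) \<bullet> x > 0})"
    by (auto simp: A_def agrees_def inner_axis')
  then have "convex A"
    by (simp add: convex_INT convex_halfspace_gt del: inner_scaleR_left)
  moreover have "W \<inter> F \<inter> A = {}"
    using no by (auto simp: F_def A_def)
  ultimately obtain v b where v: "v \<noteq> 0" "\<forall>x\<in>W \<inter> F. v \<bullet> x \<le> b" "\<forall>x\<in>A. b \<le> v \<bullet> x"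
    using separating_hyperplane_sets[of "W \<inter> F" A] L subspace_imp_convex subspace_0 pA by blast
  have b: "0 \<le> b"
    using v(2) subspace_0[OF L] by (metis inner_zero_right)
  have "v \<bullet> x = 0" if x: "x \<in> W \<inter> F" for x
  proof (rule ccontr)
    assume "v \<bullet> x \<noteq> 0"
    \<comment> \<open>The factor makes the inner product with \<open>v\<close> equal to
      \<open>b + 1\<close>, which exceeds the bound.\<close>
    moreover have "((b + 1) / (v \<bullet> x)) *\<^sub>R x \<in> W \<inter> F"
      using L x by (rule subspace_scale)
    ultimately have "v \<bullet> (((b + 1) / (v \<bullet> x)) *\<^sub>R x) \<le> b"
      using v(2) by blast
    with \<open>v \<bullet> x \<noteq> 0\<close> show False
      by simp
  qed
  then have "v \<in> orthogonal_comp (W \<inter> F)"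
    by (simp add: orthogonal_comp_def orthogonal_def inner_commute)
  then obtain y z :: "real ^ 'j" where yz: "y \<in> orthogonal_comp W" "z \<in> orthogonal_comp F" "v = y + z"
    using orthogonal_comp_Int[OF W F] by blast
  have z: "z $ a = 0" if "a \<notin> Z" for a
  proof -
    have "axis a 1 \<in> F"
      using that by (auto simp: F_def axis_def)
    then have "axis a 1 \<bullet> z = 0"
      using yz(2) by (rule orthogonal_compD)
    then show ?thesis by (simp add: inner_axis')
  qed
  have vp: "0 \<le> v \<bullet> p + t * v $ c" if "p + t *\<^sub>R axis c 1 \<in> A" for t c
  proof -
    have "b \<le> v \<bullet> (p + t *\<^sub>R axis c 1)"
      using v(3) that by blast
    then show ?thesis
      using b by (simp add: inner_add_right inner_axis)
  qed
  \<comment> \<open>An affine function that is nonnegative on the half-line has nonnegative slope: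
    with a negative slope, the parameter chosen below would give a value of at most -1.\<close>
  have unb: "0 \<le> m" if "\<And>t. t \<ge> 0 \<Longrightarrow> 0 \<le> r + t * m" for r m :: real
  proof (rule ccontr)
    assume "\<not> 0 \<le> m"
    then have "0 \<le> r + (\<bar>r\<bar> + 1) / (- m) * m"
      by (intro that divide_nonneg_nonneg[of "\<bar>r\<bar> + 1" "- m"]) auto
    moreover have "(\<bar>r\<bar> + 1) / (- m) * m = - (\<bar>r\<bar> + 1)"
      using \<open>\<not> 0 \<le> m\<close> by simp
    ultimately show False by linarith
  qed
  \<comment> \<open>Pushing \<open>p\<close> along the axis \<open>c\<close> in the direction of its
    own sign never leaves \<open>A\<close>.\<close>
  have vP: "0 \<le> sign_of S c * v $ c" if "c \<in> P" for c
  proof (rule unb)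
    fix t :: real assume "t \<ge> 0"
    then have "p + (t * sign_of S c) *\<^sub>R axis c 1 \<in> A"
      using pA by (auto simp: A_def agrees_def p_def axis_def algebra_simps sign_of_def)
    then show "0 \<le> v \<bullet> p + t * (sign_of S c * v $ c)"
      using vp[of "t * sign_of S c" c] by (simp add: mult.assoc)
  qed
  \<comment> \<open>The coordinate \<open>c\<close> is unconstrained in \<open>A\<close>, so both
    directions are available and the slope must be zero.\<close>
  have vN: "v $ c = 0" if "c \<notin> P" for c
  proof -
    have "p + t *\<^sub>R axis c 1 \<in> A" for t
      using pA that by (auto simp: A_def agrees_def p_def axis_def)
    then have *: "0 \<le> v \<bullet> p + t * v $ c" for t
      using vp by blast
    have "0 \<le> v $ c"
      using * by (rule unb)
    moreover have "0 \<le> - (v $ c)"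
    proof (rule unb)
      show "0 \<le> v \<bullet> p + t * - (v $ c)" for t
        using *[of "- t"] by simp
    qed
    ultimately show ?thesis by simp
  qed
  have yv: "y $ a = v $ a" if "a \<notin> Z" for a
    using z[OF that] yz(3) by simp
  show ?thesis
  proof
    show "y \<in> orthogonal_comp W" by fact
    show "0 \<le> sign_of S a * y $ a" if "a \<in> P" for a
    proof -
      have "a \<notin> Z" using that PZ by blast
      then show ?thesis using vP[OF that] yv by simp
    qed
    obtain a where "v $ a \<noteq> 0"
      using v(1) by (auto simp: vec_eq_iff)
    moreover from this have "a \<in> P" using vN by blast
    moreover from this have "y $ a = v $ a" using yv PZ by blast
    ultimately show "\<exists>a\<in>P. y $ a \<noteq> 0" by metis
    show "y $ a = 0" if "a \<notin> P \<union> Z" for a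
      using that vN yv by auto
  qed
qed

section \<open>Deletion and contraction of a coordinate\<close>

text \<open>For orthogonal \<open>x\<close> and \<open>y\<close> this yields the recurring sign
  argument: a positive sum over \<open>E\<close> forces a negative product at
  \<open>e\<close>.\<close>

lemma inner_eq_sum_plus:
  fixes x y :: "real ^ 'j::finite"
  assumes "e \<notin> E" and "\<And>a. a \<notin> insert e E \<Longrightarrow> x $ a * y $ a = 0"
  shows "x \<bullet> y = x $ e * y $ e + (\<Sum>a\<in>E. x $ a * y $ a)"
proof -
  have "x \<bullet> y = (\<Sum>a\<in>insert e E. x $ a * y $ a)"
    unfolding inner_vec_def inner_real_def
    using assms(2) by (intro sum.mono_neutral_right) auto
  then show ?thesis
    using assms(1) by simp
qed

lemma sign_of_mult_cancel: "(sign_of S a * x) * (sign_of S a * y) = x * y"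
  by (simp add: sign_of_def)

text \<open>If \<open>x\<^sub>e\<close> cannot be made to vanish, Gordan's alternative yields a dual vector \<open>u\<close> with signs \<open>S\<close>, and
  \<open>x \<bullet> u = 0\<close> makes the signs of \<open>u\<^sub>e\<close> and \<open>y\<^sub>e\<close> opposite, so that a positive combination of
  \<open>y\<close> and \<open>u\<close> vanishes at \<open>e\<close>.\<close>

lemma coordinate_vanishes_primal_or_dual:
  fixes W :: "(real ^ 'j::finite) set"
  assumes W: "subspace W" and part: "C \<union> D \<union> insert e E = UNIV" "C \<inter> E = {}" "e \<notin> E"
    and x: "x \<in> W" "\<forall>a\<in>C. x $ a = 0" "agrees S E (($) x)"
    and y: "y \<in> orthogonal_comp W" "\<forall>a\<in>D. y $ a = 0" "agrees S (E - {j}) (($) y)"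
    and xy: "0 < x $ e * y $ e" and e: "e \<notin> D" "D \<inter> E = {}" "C \<inter> D = {}"
  shows "(\<exists>x\<in>W. (\<forall>a\<in>insert e C. x $ a = 0) \<and> agrees S E (($) x)) \<or>
    (\<exists>y\<in>orthogonal_comp W. (\<forall>a\<in>insert e D. y $ a = 0) \<and> agrees S (E - {j}) (($) y))"
  (is "?X \<or> ?Y")
proof -
  have ?Y if no: "\<not> (\<exists>x\<in>W. (\<forall>a\<in>insert e C. x $ a = 0) \<and> agrees S E (($) x))"
  proof -
    have "E \<inter> insert e C = {}"
      using part by auto
    then obtain u where u: "u \<in> orthogonal_comp W" "\<And>a. a \<in> E \<Longrightarrow> 0 \<le> sign_of S a * u $ a"
      "\<exists>a\<in>E. u $ a \<noteq> 0" "\<And>a. a \<notin> E \<union> insert e C \<Longrightarrow> u $ a = 0"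
      using gordan[OF W _ no] by metis
    have uD: "u $ a = 0" if "a \<in> D" for a
      using u(4) that e by blast
    have "0 = x $ e * u $ e + (\<Sum>a\<in>E. x $ a * u $ a)"
      using inner_eq_sum_plus[of e E x u] orthogonal_compD[OF x(1) u(1)] x(2) uD part by fastforce
    moreover have "0 < (\<Sum>a\<in>E. x $ a * u $ a)"
    proof -
      obtain a where a: "a \<in> E" "u $ a \<noteq> 0" using u(3) by blast
      have *: "0 \<le> x $ b * u $ b" if "b \<in> E" for b
      proof -
        have "0 \<le> (sign_of S b * x $ b) * (sign_of S b * u $ b)"
          using x(3) that u(2)[OF that] unfolding agrees_def
          by (metis mult_nonneg_nonneg less_imp_le)
        then show ?thesis by (simp only: sign_of_mult_cancel)
      qed
      moreover have "x $ a \<noteq> 0"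
        using x(3) a(1) by (auto simp: agrees_def)
      ultimately show ?thesis
        using a by (intro sum_pos2[of E a]) (auto simp: order_less_le)
    qed
    ultimately have "x $ e * u $ e < 0" by linarith
    with xy have yu: "(y $ e > 0 \<and> u $ e < 0) \<or> (y $ e < 0 \<and> u $ e > 0)"
      by (auto simp: zero_less_mult_iff mult_less_0_iff)
    define z where "z = \<bar>u $ e\<bar> *\<^sub>R y + \<bar>y $ e\<bar> *\<^sub>R u"
    have "z \<in> orthogonal_comp W"
      unfolding z_def using y(1) u(1)
      by (intro subspace_add subspace_scale subspace_orthogonal_comp)
    moreover have "z $ e = 0"
      using yu by (auto simp: z_def)
    moreover have "z $ a = 0" if "a \<in> D" for a
      using that y(2) uD by (simp add: z_def)
    moreover have "agrees S (E - {j}) (($) z)"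
      unfolding agrees_def
    proof
      fix a assume a: "a \<in> E - {j}"
      \<comment> \<open>The vector \<open>u\<close> agrees with \<open>S\<close> only weakly;
        strictness comes from \<open>y\<close>, whose weight is nonzero.\<close>
      have "0 < \<bar>u $ e\<bar> * (sign_of S a * y $ a) + \<bar>y $ e\<bar> * (sign_of S a * u $ a)"
        using a y(3) u(2) yu
        by (intro add_pos_nonneg mult_pos_pos[of "\<bar>u $ e\<bar>"] mult_nonneg_nonneg[of "\<bar>y $ e\<bar>"])
          (auto simp: agrees_def)
      then show "0 < sign_of S a * z $ a"
        by (simp add: z_def algebra_simps)
    qed
    ultimately show ?Y
      by auto
  qed
  then show ?thesis by blast
qed

text \<open>The coordinates in \<open>C\<close> have been contracted and those in \<open>D\<close> deleted; \<open>E\<close> is the remaining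
  ground set. The condition \<open>p \<in> S\<close> selects one of the patterns \<open>S\<close> and \<open>E - S\<close>.\<close>

definition sign_sets ::
    "(real ^ 'j::finite) set \<Rightarrow> 'j \<Rightarrow> 'j \<Rightarrow> 'j set \<Rightarrow> 'j set \<Rightarrow> 'j set \<Rightarrow> 'j set set" where
  "sign_sets W p j C D E = {S. S \<subseteq> E \<and> p \<in> S \<and>
     (\<exists>x\<in>W. (\<forall>a\<in>C. x $ a = 0) \<and> agrees S E (($) x)) \<and>
     (\<exists>y\<in>orthogonal_comp W. (\<forall>a\<in>D. y $ a = 0) \<and> agrees S (E - {j}) (($) y))}"

lemma agrees_cong: "S \<inter> E = T \<inter> E \<Longrightarrow> agrees S E g = agrees T E g"
  unfolding agrees_def sign_of_def by (rule ball_cong) auto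

lemma agrees_split:
  assumes "e \<in> E"
  shows "agrees S E g \<longleftrightarrow> 0 < sign_of S e * g e \<and> agrees S (E - {e}) g"
  using assms by (auto simp: agrees_def)

lemma agrees_insert_iff:
  assumes "e \<in> E"
  shows "agrees (insert e S) E g \<longleftrightarrow> 0 < g e \<and> agrees S (E - {e}) g"
  using agrees_split[OF assms, of "insert e S" g] agrees_cong[of "insert e S" "E - {e}" S g]
  by (simp add: sign_of_def Int_Diff)

lemma agrees_notin_iff:
  assumes "e \<in> E" and "e \<notin> S"
  shows "agrees S E g \<longleftrightarrow> g e < 0 \<and> agrees S (E - {e}) g"
  using agrees_split[OF assms(1), of S g] assms(2) by (simp add: sign_of_def)

text \<open>Equivalently, the signs of the \<open>e\<close>-th coordinate realised by vectors agreeing with \<open>S\<close> on \<open>E\<close> form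
  one of the sets \<open>{}\<close>, \<open>{+}\<close>, \<open>{-}\<close>, \<open>{+,0,-}\<close>.\<close>

lemma agrees_coordinate_signs:
  fixes U :: "(real ^ 'j::finite) set"
  assumes U: "subspace U" and w: "w \<in> U" "w $ e \<noteq> 0"
  shows "(\<exists>x\<in>U. agrees S E (($) x) \<and> x $ e = 0) \<longleftrightarrow>
    (\<exists>x\<in>U. agrees S E (($) x) \<and> 0 < x $ e) \<and> (\<exists>x\<in>U. agrees S E (($) x) \<and> x $ e < 0)"
proof
  assume "\<exists>x\<in>U. agrees S E (($) x) \<and> x $ e = 0"
  then obtain x where x: "x \<in> U" "agrees S E (($) x)" "x $ e = 0" by blast
  have *: "\<exists>x\<in>U. agrees S E (($) x) \<and> 0 < c * x $ e" if c: "c \<noteq> 0" for c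
  proof -
    \<comment> \<open>The factor \<open>c * w $ e\<close> turns the change at \<open>e\<close>,
      multiplied by \<open>c\<close>, into a positive multiple of a square, whatever the sign of
      \<open>w $ e\<close>.\<close>
    obtain \<epsilon> where \<epsilon>: "\<epsilon> > 0" "agrees S E (\<lambda>a. x $ a + \<epsilon> * (c * w $ e * w $ a))"
      using agrees_perturb[OF x(2)] .
    show ?thesis
    proof (intro bexI conjI)
      show "x + (\<epsilon> * (c * w $ e)) *\<^sub>R w \<in> U"
        using U x(1) w(1) by (intro subspace_add subspace_scale)
      show "agrees S E (($) (x + (\<epsilon> * (c * w $ e)) *\<^sub>R w))"
        using \<epsilon>(2) by (simp add: agrees_def mult.assoc)
      have "c * (x + (\<epsilon> * (c * w $ e)) *\<^sub>R w) $ e = \<epsilon> * (c * w $ e)\<^sup>2"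
        using x(3) by (simp add: power2_eq_square)
      also have "\<dots> > 0"
        using \<epsilon>(1) c w(2) by simp
      finally show "0 < c * (x + (\<epsilon> * (c * w $ e)) *\<^sub>R w) $ e" .
    qed
  qed
  show "(\<exists>x\<in>U. agrees S E (($) x) \<and> 0 < x $ e) \<and> (\<exists>x\<in>U. agrees S E (($) x) \<and> x $ e < 0)"
    using *[of 1] *[of "-1"] by simp
next
  assume "(\<exists>x\<in>U. agrees S E (($) x) \<and> 0 < x $ e) \<and> (\<exists>x\<in>U. agrees S E (($) x) \<and> x $ e < 0)"
  then obtain x y where x: "x \<in> U" "agrees S E (($) x)" "0 < x $ e"
    and y: "y \<in> U" "agrees S E (($) y)" "y $ e < 0" by blast
  show "\<exists>x\<in>U. agrees S E (($) x) \<and> x $ e = 0"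
  proof (intro bexI conjI)
    \<comment> \<open>Both coefficients are positive, and they cancel the coordinate
      \<open>e\<close>.\<close>
    show "(- (y $ e)) *\<^sub>R x + (x $ e) *\<^sub>R y \<in> U"
      using U x(1) y(1) by (intro subspace_add subspace_scale)
    show "agrees S E (($) ((- (y $ e)) *\<^sub>R x + (x $ e) *\<^sub>R y))"
      using agrees_comb[OF x(2) y(2), of "- (y $ e)" "x $ e"] x(3) y(3) by (simp add: agrees_def)
  qed simp
qed

lemma card_split_at:
  assumes "finite \<A>" and "\<And>S. S \<in> \<A> \<Longrightarrow> S \<subseteq> E" and "e \<in> E"
  shows "card \<A> = card {S. S \<subseteq> E - {e} \<and> insert e S \<in> \<A>} + card {S. S \<subseteq> E - {e} \<and> S \<in> \<A>}"
proof -
  have "card {S. S \<subseteq> E - {e} \<and> insert e S \<in> \<A>} = card {S \<in> \<A>. e \<in> S}"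
  proof (rule bij_betw_same_card)
    show "bij_betw (insert e) {S. S \<subseteq> E - {e} \<and> insert e S \<in> \<A>} {S \<in> \<A>. e \<in> S}"
      using assms(2,3)
      by (intro bij_betwI[where g = "\<lambda>S. S - {e}"]) (auto simp: insert_absorb)
  qed
  moreover have "{S. S \<subseteq> E - {e} \<and> S \<in> \<A>} = {S \<in> \<A>. e \<notin> S}"
    using assms(2) by blast
  moreover have "card \<A> = card {S \<in> \<A>. e \<in> S} + card {S \<in> \<A>. e \<notin> S}"
    using assms(1) by (subst card_Un_disjoint[symmetric]) (auto intro: arg_cong[where f = card])
  ultimately show ?thesis by simp
qed

text \<open>Removing \<open>e\<close> from the patterns gives two families \<open>?pos\<close> and
  \<open>?neg\<close>, according to the sign at \<open>e\<close>. They have the same union and the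
  same intersection as the families of the deletion \<open>?del\<close> and the contraction
  \<open>?con\<close>, so the cardinalities add up equally. The vectors \<open>w\<close> and
  \<open>u\<close> ensure that the coordinate \<open>e\<close> is not identically zero on either
  side, as the perturbation argument requires.\<close>

lemma card_sign_sets_step:
  fixes W :: "(real ^ 'j::finite) set"
  assumes W: "subspace W" and part: "C \<union> D \<union> E = UNIV" "C \<inter> E = {}" "D \<inter> E = {}" "C \<inter> D = {}"
    and e: "e \<in> E" "e \<noteq> p" "e \<noteq> j"
    and w: "w \<in> W" "\<forall>a\<in>C. w $ a = 0" "w $ e \<noteq> 0"
    and u: "u \<in> orthogonal_comp W" "\<forall>a\<in>D. u $ a = 0" "u $ e \<noteq> 0"
  shows "card (sign_sets W p j C D E) =
    card (sign_sets W p j C (insert e D) (E - {e})) + card (sign_sets W p j (insert e C) D (E - {e}))"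
proof -
  define U where "U = W \<inter> {x. \<forall>a\<in>C. x $ a = 0}"
  define V where "V = orthogonal_comp W \<inter> {x. \<forall>a\<in>D. x $ a = 0}"
  have U: "subspace U" and V: "subspace V"
    unfolding U_def V_def using W subspace_orthogonal_comp
    by (auto intro!: subspace_inter simp: subspace_def)
  let ?E = "E - {e}"
  \<comment> \<open>\<open>X S\<close> and \<open>Y S\<close> record which signs at \<open>e\<close>
    occur among primal and dual vectors that have the signs \<open>S\<close> on the remaining
    indices.\<close>
  define X where "X S Q \<longleftrightarrow> (\<exists>x\<in>U. agrees S ?E (($) x) \<and> Q (x $ e))" for S and Q :: "real \<Rightarrow> bool"
  define Y where "Y S Q \<longleftrightarrow> (\<exists>y\<in>V. agrees S (?E - {j}) (($) y) \<and> Q (y $ e))" for S and Q :: "real \<Rightarrow> bool"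
  let ?P = "\<lambda>t::real. 0 < t" and ?N = "\<lambda>t::real. t < 0" and ?Z = "\<lambda>t::real. t = 0" and ?T = "\<lambda>t::real. True"
  let ?pos = "{S. S \<subseteq> ?E \<and> insert e S \<in> sign_sets W p j C D E}"
  let ?neg = "{S. S \<subseteq> ?E \<and> S \<in> sign_sets W p j C D E}"
  let ?del = "sign_sets W p j C (insert e D) ?E"
  let ?con = "sign_sets W p j (insert e C) D ?E"
  have E: "E - {j} - {e} = ?E - {j}"
    by blast
  have a1: "agrees (insert e S) E g \<longleftrightarrow> 0 < g e \<and> agrees S ?E g"
    and a2: "agrees (insert e S) (E - {j}) g \<longleftrightarrow> 0 < g e \<and> agrees S (?E - {j}) g" for S g
    using agrees_insert_iff[of e E S g] agrees_insert_iff[of e "E - {j}" S g, unfolded E] e by auto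
  have b1: "agrees S E g \<longleftrightarrow> g e < 0 \<and> agrees S ?E g"
    and b2: "agrees S (E - {j}) g \<longleftrightarrow> g e < 0 \<and> agrees S (?E - {j}) g" if "e \<notin> S" for S g
    using agrees_notin_iff[of e E S g] agrees_notin_iff[of e "E - {j}" S g, unfolded E] e that by auto
  have X: "X S Q \<longleftrightarrow> (\<exists>x\<in>W. (\<forall>a\<in>C. x $ a = 0) \<and> agrees S ?E (($) x) \<and> Q (x $ e))"
    and Y: "Y S Q \<longleftrightarrow> (\<exists>y\<in>orthogonal_comp W. (\<forall>a\<in>D. y $ a = 0) \<and> agrees S (?E - {j}) (($) y) \<and> Q (y $ e))"
    for S Q
    unfolding X_def Y_def U_def V_def by auto
  have XP: "(\<exists>x\<in>W. (\<forall>a\<in>C. x $ a = 0) \<and> agrees (insert e S) E (($) x)) \<longleftrightarrow> X S ?P"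
    and YP: "(\<exists>y\<in>orthogonal_comp W. (\<forall>a\<in>D. y $ a = 0) \<and> agrees (insert e S) (E - {j}) (($) y)) \<longleftrightarrow> Y S ?P"
    for S
    unfolding X Y a1 a2 by (simp_all only: conj_commute)
  have XN: "(\<exists>x\<in>W. (\<forall>a\<in>C. x $ a = 0) \<and> agrees S E (($) x)) \<longleftrightarrow> X S ?N"
    and YN: "(\<exists>y\<in>orthogonal_comp W. (\<forall>a\<in>D. y $ a = 0) \<and> agrees S (E - {j}) (($) y)) \<longleftrightarrow> Y S ?N"
    if "e \<notin> S" for S
    unfolding X Y b1[OF that] b2[OF that] by (simp_all only: conj_commute)
  have pos: "?pos = {S. S \<subseteq> ?E \<and> p \<in> S \<and> X S ?P \<and> Y S ?P}"
    using e unfolding sign_sets_def mem_Collect_eq XP YP by auto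
  have neg: "?neg = {S. S \<subseteq> ?E \<and> p \<in> S \<and> X S ?N \<and> Y S ?N}"
    unfolding sign_sets_def mem_Collect_eq using XN YN by blast
  have del: "?del = {S. S \<subseteq> ?E \<and> p \<in> S \<and> X S ?T \<and> Y S ?Z}"
    unfolding sign_sets_def X Y by (simp only: ball_simps conj_assoc conj_left_commute conj_commute simp_thms)
  have con: "?con = {S. S \<subseteq> ?E \<and> p \<in> S \<and> X S ?Z \<and> Y S ?T}"
    unfolding sign_sets_def X Y by (simp only: ball_simps conj_assoc conj_left_commute conj_commute simp_thms)
  have X0: "X S ?Z \<longleftrightarrow> X S ?P \<and> X S ?N" for S
    unfolding X_def by (rule agrees_coordinate_signs[OF U, of w]) (use w in \<open>auto simp: U_def\<close>)
  have Y0: "Y S ?Z \<longleftrightarrow> Y S ?P \<and> Y S ?N" for S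
    unfolding Y_def by (rule agrees_coordinate_signs[OF V, of u]) (use u in \<open>auto simp: V_def\<close>)
  have T: "X S ?T \<longleftrightarrow> X S ?P \<or> X S ?N \<or> X S ?Z" "Y S ?T \<longleftrightarrow> Y S ?P \<or> Y S ?N \<or> Y S ?Z" for S
    unfolding X_def Y_def by (meson linorder_neqE_linordered_idom)+
  have cross: "X S ?Z \<or> Y S ?Z"
    if xy: "x \<in> U" "agrees S ?E (($) x)" "y \<in> V" "agrees S (?E - {j}) (($) y)" "0 < x $ e * y $ e"
    for S x y
  proof -
    have "(\<exists>x\<in>W. (\<forall>a\<in>insert e C. x $ a = 0) \<and> agrees S ?E (($) x)) \<or>
      (\<exists>y\<in>orthogonal_comp W. (\<forall>a\<in>insert e D. y $ a = 0) \<and> agrees S (?E - {j}) (($) y))"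
      by (rule coordinate_vanishes_primal_or_dual[OF W, of C D e ?E x S y j]) (use xy part e in \<open>auto simp: U_def V_def\<close>)
    then show ?thesis
      unfolding X_def Y_def U_def V_def by blast
  qed
  have P: "X S ?Z \<or> Y S ?Z" if "X S ?P" "Y S ?P" for S
    using that cross unfolding X_def[of S ?P] Y_def[of S ?P] by (meson mult_pos_pos)
  have N: "X S ?Z \<or> Y S ?Z" if "X S ?N" "Y S ?N" for S
    using that cross unfolding X_def[of S ?N] Y_def[of S ?N] by (meson mult_neg_neg)
  \<comment> \<open>Equal signs at \<open>e\<close> on both sides allow one side to vanish there, by
    \<open>P\<close> and \<open>N\<close>. Conversely, a side that can vanish at \<open>e\<close>
    realises both signs and so can match any sign of the other side.\<close>
  have Un: "?pos \<union> ?neg = ?del \<union> ?con"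
    unfolding pos neg del con T using X0 Y0 P N by blast
  have Int: "?pos \<inter> ?neg = ?del \<inter> ?con"
    unfolding pos neg del con T using X0 Y0 by blast
  have "card (sign_sets W p j C D E) = card ?pos + card ?neg"
    using e by (intro card_split_at) (auto simp: sign_sets_def)
  also have "\<dots> = card (?pos \<union> ?neg) + card (?pos \<inter> ?neg)"
    by (intro card_Un_Int finite)
  also have "\<dots> = card (?del \<union> ?con) + card (?del \<inter> ?con)"
    by (simp only: Un Int)
  also have "\<dots> = card ?del + card ?con"
    by (intro card_Un_Int[symmetric] finite)
  finally show ?thesis .
qed

text \<open>Since \<open>e\<close> lies in both \<open>E\<close> and \<open>E - {j}\<close>, a
  pattern needs vectors that are nonzero at \<open>e\<close> on both sides. This covers the
  degenerate case left out by the recursion.\<close>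

lemma sign_sets_eq_emptyI:
  assumes e: "e \<in> E" "e \<noteq> j"
    and no: "\<not> (\<exists>x\<in>W. (\<forall>a\<in>C. x $ a = 0) \<and> x $ e \<noteq> 0) \<or>
      \<not> (\<exists>y\<in>orthogonal_comp W. (\<forall>a\<in>D. y $ a = 0) \<and> y $ e \<noteq> 0)"
  shows "sign_sets W p j C D E = {}"
proof (rule equals0I)
  fix S assume "S \<in> sign_sets W p j C D E"
  then obtain x y where x: "x \<in> W" "\<forall>a\<in>C. x $ a = 0" "agrees S E (($) x)"
    and y: "y \<in> orthogonal_comp W" "\<forall>a\<in>D. y $ a = 0" "agrees S (E - {j}) (($) y)"
    unfolding sign_sets_def by blast
  have "x $ e \<noteq> 0" "y $ e \<noteq> 0"
    using agrees_nonzero[OF x(3)] agrees_nonzero[OF y(3)] e by auto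
  with x(1,2) y(1,2) no show False by blast
qed

text \<open>Base case of the independence of \<open>j\<close>. With two indices left, orthogonality
  makes the products of \<open>x\<close> and \<open>y\<close> at \<open>i\<close> and
  \<open>j\<close> opposite, so \<open>- y\<close> has at \<open>i\<close> the sign that
  \<open>y\<close> has at \<open>j\<close> relative to \<open>S\<close>.\<close>

lemma sign_sets_pair:
  fixes W :: "(real ^ 'j::finite) set"
  assumes ij: "i \<noteq> j" and part: "C \<union> D \<union> {i, j} = UNIV"
  shows "sign_sets W p i C D {i, j} \<subseteq> sign_sets W p j C D {i, j}"
proof
  fix S assume "S \<in> sign_sets W p i C D {i, j}"
  then obtain x y where S: "S \<subseteq> {i, j}" "p \<in> S"
    and x: "x \<in> W" "\<forall>a\<in>C. x $ a = 0" "agrees S {i, j} (($) x)"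
    and y: "y \<in> orthogonal_comp W" "\<forall>a\<in>D. y $ a = 0" "agrees S ({i, j} - {i}) (($) y)"
    by (auto simp: sign_sets_def)
  have "0 = x $ i * y $ i + (\<Sum>a\<in>{j}. x $ a * y $ a)"
    using inner_eq_sum_plus[of i "{j}" x y] orthogonal_compD[OF x(1) y(1)] x(2) y(2) part ij
    by fastforce
  then have "x $ i * y $ i + x $ j * y $ j = 0" by simp
  moreover have sx: "0 < sign_of S i * x $ i" "0 < sign_of S j * x $ j" "0 < sign_of S j * y $ j"
    using x(3) y(3) ij by (auto simp: agrees_def)
  then have "0 < x $ j * y $ j"
    using sign_of_mult_pos_iff by metis
  ultimately have "0 < x $ i * (- y) $ i" by simp
  then have "0 < sign_of S i * (- y) $ i"
    using sign_of_mult_pos_iff[OF sx(1)] by blast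
  then have "agrees S ({i, j} - {j}) (($) (- y))"
    using ij by (auto simp: agrees_def)
  moreover have "\<forall>a\<in>D. (- y) $ a = 0"
    using y(2) by simp
  moreover have "- y \<in> orthogonal_comp W"
    using y(1) by (intro subspace_neg subspace_orthogonal_comp)
  ultimately show "S \<in> sign_sets W p j C D {i, j}"
    using S x unfolding sign_sets_def mem_Collect_eq by blast
qed

text \<open>Induction on the ground set: a third index \<open>e\<close> is removed by deletion and
  contraction until only \<open>i\<close> and \<open>j\<close> remain. The selector is
  \<open>i\<close> in both counts, so it is never removed.\<close>

theorem card_sign_sets_independent:
  fixes W :: "(real ^ 'j::finite) set"
  assumes W: "subspace W" and "C \<union> D \<union> E = UNIV" "C \<inter> E = {}" "D \<inter> E = {}" "C \<inter> D = {}"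
    and "i \<in> E" "j \<in> E"
  shows "card (sign_sets W i i C D E) = card (sign_sets W i j C D E)"
  using assms(2-)
proof (induction "card E" arbitrary: C D E)
  case 0
  then show ?case by simp
next
  case (Suc m)
  consider "i = j" | "i \<noteq> j" "E = {i, j}" | e where "i \<noteq> j" "e \<in> E" "e \<noteq> i" "e \<noteq> j"
    using Suc.prems by blast
  then show ?case
  proof cases
    case 2
    with Suc.prems have "sign_sets W i i C D E = sign_sets W i j C D E"
      using sign_sets_pair[of i j C D W i] sign_sets_pair[of j i C D W i]
      by (simp add: insert_commute)
    then show ?thesis by simp
  next
    case (3 e)
    show ?thesis
    proof (cases "\<exists>w u. w \<in> W \<and> (\<forall>a\<in>C. w $ a = 0) \<and> w $ e \<noteq> 0 \<and>
        u \<in> orthogonal_comp W \<and> (\<forall>a\<in>D. u $ a = 0) \<and> u $ e \<noteq> 0")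
      case True
      then obtain w u where wu: "w \<in> W" "\<forall>a\<in>C. w $ a = 0" "w $ e \<noteq> 0"
        "u \<in> orthogonal_comp W" "\<forall>a\<in>D. u $ a = 0" "u $ e \<noteq> 0" by blast
      have m: "m = card (E - {e})"
        using Suc.hyps(2) 3 by simp
      have "card (sign_sets W i i C (insert e D) (E - {e})) = card (sign_sets W i j C (insert e D) (E - {e}))"
        by (rule Suc.hyps(1)[OF m]) (use Suc.prems 3 in auto)
      moreover have "card (sign_sets W i i (insert e C) D (E - {e})) = card (sign_sets W i j (insert e C) D (E - {e}))"
        by (rule Suc.hyps(1)[OF m]) (use Suc.prems 3 in auto)
      ultimately show ?thesis
        using card_sign_sets_step[OF W Suc.prems(1-4) \<open>e \<in> E\<close> \<open>e \<noteq> i\<close> _ wu, of i]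
          card_sign_sets_step[OF W Suc.prems(1-4) \<open>e \<in> E\<close> \<open>e \<noteq> i\<close> _ wu, of j] 3
        by simp
    next
      case False
      then have "sign_sets W i k C D E = {}" if "e \<noteq> k" for k
        using \<open>e \<in> E\<close> that by (intro sign_sets_eq_emptyI[of e]) blast+
      with 3 show ?thesis by simp
    qed
  qed simp
qed

section \<open>Domains of a projective arrangement\<close>

text \<open>Each member is clopen, its complement being the union of the other members. A component
  that meets it therefore stays inside it, and connectedness gives the reverse inclusion.\<close>

lemma connected_components_of_open_partition:
  assumes top: "topspace X = \<Union>\<U>" and disj: "disjoint \<U>"
    and \<U>: "\<And>U. U \<in> \<U> \<Longrightarrow> openin X U \<and> connectedin X U \<and> U \<noteq> {}"
  shows "connected_components_of X = \<U>"
proof -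
  have *: "connected_component_of_set X x = U" if "U \<in> \<U>" "x \<in> U" for U x
  proof
    have "topspace X - U = \<Union>(\<U> - {U})"
      using top disj that(1) by (auto simp: disjoint_def)
    moreover have "openin X (\<Union>(\<U> - {U}))"
      using \<U> by (intro openin_Union) blast
    ultimately have "closedin X U"
      using \<U> that(1) by (simp add: closedin_def openin_subset)
    then have "connected_component_of_set X x \<subseteq> U \<or> disjnt (connected_component_of_set X x) U"
      using \<U> that(1) by (intro connectedin_clopen_cases) (auto simp: connectedin_connected_component_of)
    moreover have "x \<in> connected_component_of_set X x"
      using that top by (auto simp: connected_component_of_refl)
    ultimately show "connected_component_of_set X x \<subseteq> U"
      using that(2) by (auto simp: disjnt_iff)
    show "U \<subseteq> connected_component_of_set X x"
      using \<U> that by (intro connected_component_of_maximal) auto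
  qed
  then show ?thesis
    using top \<U> unfolding connected_components_of_def
    by (auto simp: image_iff) (metis all_not_in_conv)
qed

text \<open>The abstract setting lets one argument serve \<open>W\<close> and \<open>W'\<close>,
  which live in different types.\<close>

locale arrangement =
  fixes V :: "'a::real_normed_vector set" and f :: "'j::finite \<Rightarrow> 'a \<Rightarrow> real"
  assumes V: "subspace V" and f: "\<And>a. bounded_linear (f a)"
begin

lemma f_scaleR [simp]: "f a (c *\<^sub>R v) = c * f a v"
  by (simp add: f linear_simps(5))

lemma f_add [simp]: "f a (v + w) = f a v + f a w"
  by (simp add: f linear_simps(1))

lemma f_minus [simp]: "f a (- v) = - f a v"
  using f_scaleR[of a "- 1" v] by simp

lemma f_zero [simp]: "f a 0 = 0"
  by (simp add: f linear_simps)

lemma continuous_f [continuous_intros]: "continuous_on A (f a)"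
  by (simp add: f linear_continuous_on)

definition sign_cone :: "'j set \<Rightarrow> 'a set" where
  "sign_cone S = {v \<in> V. agrees S UNIV (\<lambda>a. f a v)}"

definition region :: "'j set \<Rightarrow> 'a set set" where
  "region S = (\<lambda>v. span {v}) ` sign_cone S"

definition weakly_agrees :: "'j set \<Rightarrow> 'a \<Rightarrow> bool" where
  "weakly_agrees S v \<longleftrightarrow> (\<forall>a. 0 \<le> sign_of S a * f a v)"

lemma sign_cone_nonzero: "v \<in> sign_cone S \<Longrightarrow> f a v \<noteq> 0"
  by (force simp: sign_cone_def agrees_def dest: spec[of _ a])

lemma zero_notin_sign_cone [simp]: "0 \<notin> sign_cone S"
  using sign_cone_nonzero[of 0] by auto

lemma sign_coneD: "v \<in> sign_cone S \<Longrightarrow> v \<in> V" "v \<in> sign_cone S \<Longrightarrow> v \<noteq> 0"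
  using zero_notin_sign_cone unfolding sign_cone_def by blast+

lemma sign_cone_scaleR: "v \<in> sign_cone S \<Longrightarrow> c > 0 \<Longrightarrow> c *\<^sub>R v \<in> sign_cone S"
  using V by (auto simp: sign_cone_def agrees_def subspace_scale mult.left_commute[of _ c] mult_pos_pos)

lemma span_eqE:
  fixes v w :: 'a
  assumes "span {v} = span {w}" and "v \<noteq> 0"
  obtains c where "c \<noteq> 0" and "v = c *\<^sub>R w"
proof -
  have "v \<in> span {w}"
    using assms(1) span_base[of v "{v}"] by simp
  then obtain c where "v = c *\<^sub>R w"
    by (auto simp: span_singleton)
  with assms(2) that show ?thesis by auto
qed

lemma span_minus: "span {- v} = span {v :: 'a}"
proof -
  have "v \<in> span {- v}"
    using span_neg[of "- v" "{- v}"] by (simp add: span_base)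
  then show ?thesis
    by (simp add: span_eq span_neg span_base)
qed

text \<open>A line determines its spanning vector up to a nonzero scalar, and cones absorb positive
  scalars, so only a sign remains ambiguous.\<close>

lemma span_in_region_iff:
  assumes "v \<noteq> 0"
  shows "span {v} \<in> region S \<longleftrightarrow> v \<in> sign_cone S \<or> - v \<in> sign_cone S"
proof
  assume "span {v} \<in> region S"
  then obtain w where w: "w \<in> sign_cone S" "span {v} = span {w}"
    by (auto simp: region_def)
  then obtain c where c: "c \<noteq> 0" "v = c *\<^sub>R w"
    using span_eqE assms by metis
  show "v \<in> sign_cone S \<or> - v \<in> sign_cone S"
  proof (cases "c > 0")
    case False
    then have "(- c) *\<^sub>R w \<in> sign_cone S"
      using c w by (intro sign_cone_scaleR) auto
    then show ?thesis using c by simp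
  qed (use c w sign_cone_scaleR in auto)
qed (use span_minus in \<open>auto simp: region_def image_iff\<close>)

lemma span_in_hyperplane_iff:
  assumes "v \<in> V" "v \<noteq> 0"
  shows "span {v} \<in> hyperplane V f a \<longleftrightarrow> f a v = 0"
  using assms by (auto simp: hyperplane_def proj_space_def span_singleton intro: exI[of _ 1])

lemma complement_hyperplanes:
  "proj_space V - (\<Union>a. hyperplane V f a) = (\<Union>S\<in>{S. p \<in> S \<and> sign_cone S \<noteq> {}}. region S)"
proof (intro equalityI subsetI)
  fix L assume L: "L \<in> proj_space V - (\<Union>a. hyperplane V f a)"
  then obtain v where v: "v \<in> V" "v \<noteq> 0" "L = span {v}"
    by (auto simp: proj_space_def)
  then have nz: "f a v \<noteq> 0" for a
    using L span_in_hyperplane_iff by blast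
  have *: "w \<in> sign_cone {a. 0 < f a w}" if "w \<in> V" "\<And>a. f a w \<noteq> 0" for w
    using that by (auto simp: sign_cone_def agrees_def sign_of_def not_less order_le_less)
  \<comment> \<open>Of the two opposite representatives, the one positive at \<open>p\<close> is
    taken; this fixes the global sign.\<close>
  define w where "w = (if 0 < f p v then v else - v)"
  have "w \<in> sign_cone {a. 0 < f a w}"
    using v(1) V nz by (intro *) (auto simp: w_def subspace_neg)
  moreover have "p \<in> {a. 0 < f a w}"
    using nz[of p] by (auto simp: w_def)
  moreover have "L = span {w}"
    using v(3) span_minus by (simp add: w_def)
  ultimately show "L \<in> (\<Union>S\<in>{S. p \<in> S \<and> sign_cone S \<noteq> {}}. region S)"
    unfolding region_def by (intro UN_I[of "{a. 0 < f a w}"]) auto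
next
  fix L assume "L \<in> (\<Union>S\<in>{S. p \<in> S \<and> sign_cone S \<noteq> {}}. region S)"
  then obtain S v where v: "v \<in> sign_cone S" "L = span {v}"
    by (auto simp: region_def)
  then have "v \<in> V" "v \<noteq> 0"
    using sign_coneD by blast+
  then show "L \<in> proj_space V - (\<Union>a. hyperplane V f a)"
    using v sign_cone_nonzero span_in_hyperplane_iff by (auto simp: proj_space_def)
qed

text \<open>Positivity at \<open>p\<close> rules out opposite representatives, so a common line has
  one spanning vector in both cones, and that vector determines all signs.\<close>

lemma region_disjoint:
  assumes "p \<in> S" "p \<in> T" "region S \<inter> region T \<noteq> {}"
  shows "S = T"
proof -
  obtain v where v: "v \<in> sign_cone S" "span {v} \<in> region T"
    using assms(3) by (auto simp: region_def)
  have "v \<noteq> 0" using v(1) by auto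
  have "0 < f p v"
    using v(1) assms(1) by (auto simp: sign_cone_def agrees_def sign_of_def dest: spec[of _ p])
  then have "- v \<notin> sign_cone T"
    using assms(2) by (auto simp: sign_cone_def agrees_def sign_of_def intro!: exI[of _ p])
  then have "v \<in> sign_cone T"
    using v(2) span_in_region_iff[OF \<open>v \<noteq> 0\<close>] by blast
  with v(1) have *: "0 < sign_of S a * f a v" "0 < sign_of T a * f a v" for a
    by (auto simp: sign_cone_def agrees_def)
  have "a \<in> S \<longleftrightarrow> a \<in> T" for a
    using *[of a] by (auto simp: sign_of_def split: if_splits)
  then show ?thesis by blast
qed

lemma openin_region: "openin (proj_topology V) (region S)"
proof -
  \<comment> \<open>The preimage of a region consists of the cone and its negative.\<close>
  let ?O = "(\<Inter>a. {v. 0 < sign_of S a * f a v}) \<union> (\<Inter>a. {v. 0 < sign_of S a * f a (- v)})"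
  have "open ?O"
    unfolding f_minus
    by (intro open_Un open_INT open_Collect_less continuous_intros ballI finite)
  moreover have "{v \<in> V - {0}. span {v} \<in> region S} = (V - {0}) \<inter> ?O"
    using V span_in_region_iff by (auto simp: sign_cone_def agrees_def subspace_neg)
  ultimately show ?thesis
    unfolding openin_proj_topology using sign_coneD
    by (auto simp: openin_open_Int region_def proj_space_def)
qed

lemma connectedin_region: "connectedin (proj_topology V) (region S)"
  unfolding region_def
proof (rule connectedin_continuous_map_image)
  show "continuous_map (top_of_set (V - {0})) (proj_topology V) (\<lambda>v. span {v})"
    by (rule quotient_imp_continuous_map[OF quotient_map_proj_topology])
  have "convex (sign_cone S)"
    unfolding convex_def
  proof (intro ballI allI impI)
    fix v w and s t :: real
    assume vw: "v \<in> sign_cone S" "w \<in> sign_cone S" and st: "0 \<le> s" "0 \<le> t" "s + t = 1"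
    show "s *\<^sub>R v + t *\<^sub>R w \<in> sign_cone S"
    \<comment> \<open>The endpoints are treated apart because \<open>agrees_comb\<close> needs both
      coefficients positive.\<close>
    proof (cases "s = 0 \<or> t = 0")
      case False
      then show ?thesis
        using vw st V agrees_comb[of S UNIV "\<lambda>a. f a v" "\<lambda>a. f a w" s t]
        by (auto simp: sign_cone_def subspace_add subspace_scale)
    qed (use vw st in auto)
  qed
  moreover have "sign_cone S \<subseteq> V - {0}"
    using sign_coneD by blast
  ultimately show "connectedin (top_of_set (V - {0})) (sign_cone S)"
    by (simp add: connectedin_subtopology convex_connected)
qed

lemma domains_eq: "domains V f = region ` {S. p \<in> S \<and> sign_cone S \<noteq> {}}"
  unfolding domains_def
proof (rule connected_components_of_open_partition)
  let ?N = "{S. p \<in> S \<and> sign_cone S \<noteq> {}}"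
  let ?\<Omega> = "proj_space V - (\<Union>a. hyperplane V f a)"
  show "topspace (subtopology (proj_topology V) ?\<Omega>) = \<Union> (region ` ?N)"
    unfolding complement_hyperplanes[of p, symmetric] by (auto simp: topspace_proj_topology)
  show "disjoint (region ` ?N)"
    using region_disjoint[of p] by (intro pairwise_imageI) (auto simp: disjnt_def)
  fix U assume U: "U \<in> region ` ?N"
  then have sub: "U \<subseteq> ?\<Omega>"
    unfolding complement_hyperplanes[of p] by blast
  have "openin (proj_topology V) U" "connectedin (proj_topology V) U" "U \<noteq> {}"
    using U openin_region connectedin_region by (auto simp: region_def)
  with sub show "openin (subtopology (proj_topology V) ?\<Omega>) U \<and>
      connectedin (subtopology (proj_topology V) ?\<Omega>) U \<and> U \<noteq> {}"
    by (simp add: connectedin_subtopology openin_subtopology_alt) (metis inf.absorb2 imageI mem_Collect_eq)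
qed

text \<open>A weakly agreeing \<open>v\<close> is the limit of \<open>v + t *\<^sub>R w\<close> with
  \<open>w\<close> in the cone, so its line lies in the closure. Conversely, if no such
  \<open>v\<close> exists on the hyperplane, an open set of lines contains the hyperplane and misses
  the region.\<close>

lemma closure_of_region_meets_hyperplane_iff:
  assumes "sign_cone S \<noteq> {}"
  shows "proj_topology V closure_of region S \<inter> hyperplane V f j = {} \<longleftrightarrow>
    \<not> (\<exists>v\<in>V. v \<noteq> 0 \<and> f j v = 0 \<and> weakly_agrees S v)"
proof
  assume empty: "proj_topology V closure_of region S \<inter> hyperplane V f j = {}"
  show "\<not> (\<exists>v\<in>V. v \<noteq> 0 \<and> f j v = 0 \<and> weakly_agrees S v)"
  proof
    assume "\<exists>v\<in>V. v \<noteq> 0 \<and> f j v = 0 \<and> weakly_agrees S v"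
    then obtain v where v: "v \<in> V" "v \<noteq> 0" "f j v = 0" "weakly_agrees S v" by blast
    obtain w where w: "w \<in> sign_cone S" using assms by blast
    have "span {v} \<in> proj_topology V closure_of region S"
      unfolding in_closure_of
    proof (intro conjI allI impI)
      show "span {v} \<in> topspace (proj_topology V)"
        using v by (auto simp: topspace_proj_topology proj_space_def)
      fix T assume T: "span {v} \<in> T \<and> openin (proj_topology V) T"
      then obtain G where G: "open G" "{u \<in> V - {0}. span {u} \<in> T} = (V - {0}) \<inter> G"
        by (auto simp: openin_proj_topology openin_open)
      then have "v \<in> G" using v T by blast
      have "((\<lambda>t. v + t *\<^sub>R w) \<longlongrightarrow> v + 0 *\<^sub>R w) (at_right 0)"
        by (intro tendsto_intros)
      then have "\<forall>\<^sub>F t in at_right 0. v + t *\<^sub>R w \<in> G"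
        using G(1) \<open>v \<in> G\<close> by (intro topological_tendstoD) auto
      moreover have "\<forall>\<^sub>F t::real in at_right 0. t > 0"
        by (simp add: eventually_at_right_less)
      ultimately have "\<forall>\<^sub>F t in at_right 0. t > 0 \<and> v + t *\<^sub>R w \<in> G"
        by eventually_elim simp
      then obtain t where t: "t > 0" "v + t *\<^sub>R w \<in> G"
        using eventually_happens'[OF trivial_limit_at_right_real] by blast
      have c: "v + t *\<^sub>R w \<in> sign_cone S"
      proof -
        have "0 < sign_of S a * f a v + t * (sign_of S a * f a w)" for a
          using w v(4) t(1) by (intro add_nonneg_pos mult_pos_pos[of t])
            (auto simp: weakly_agrees_def sign_cone_def agrees_def)
        then show ?thesis
          using v(1) w V by (auto simp: sign_cone_def agrees_def subspace_add subspace_scale algebra_simps)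
      qed
      then have "v + t *\<^sub>R w \<in> V - {0}"
        using sign_coneD by blast
      with t(2) G(2) have "span {v + t *\<^sub>R w} \<in> T" by blast
      with c show "\<exists>y. y \<in> region S \<and> y \<in> T"
        by (auto simp: region_def)
    qed
    moreover have "span {v} \<in> hyperplane V f j"
      using v span_in_hyperplane_iff by blast
    ultimately show False using empty by blast
  qed
next
  assume no: "\<not> (\<exists>v\<in>V. v \<noteq> 0 \<and> f j v = 0 \<and> weakly_agrees S v)"
  let ?good = "\<lambda>v. (\<exists>a. sign_of S a * f a v < 0) \<and> (\<exists>a. sign_of S a * f a (- v) < 0)"
  \<comment> \<open>\<open>T\<close> consists of the lines for which neither a spanning vector nor
    its negative agrees weakly with \<open>S\<close>.\<close>
  define T where "T = (\<lambda>v. span {v}) ` {v \<in> V - {0}. ?good v}"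
  have pre: "{v \<in> V - {0}. span {v} \<in> T} = (V - {0}) \<inter> {v. ?good v}"
    unfolding T_def
  proof (intro equalityI subsetI)
    fix v assume v: "v \<in> {v \<in> V - {0}. span {v} \<in> (\<lambda>v. span {v}) ` {v \<in> V - {0}. ?good v}}"
    then obtain u where u: "u \<in> V - {0}" "?good u" "span {v} = span {u}" by blast
    then obtain c where c: "c \<noteq> 0" "v = c *\<^sub>R u"
      using span_eqE v by blast
    have s: "sign_of S a * f a v = c * (sign_of S a * f a u)" for a
      using c by simp
    \<comment> \<open>Rescaling by a negative factor merely exchanges the two conditions.\<close>
    have "?good v"
    proof (cases "c > 0")
      case True
      then show ?thesis
        using u(2) s by (simp add: mult_less_0_iff zero_less_mult_iff)
    next
      case False
      then show ?thesis
        using u(2) c(1) s by (auto simp: mult_less_0_iff zero_less_mult_iff not_less)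
    qed
    with v show "v \<in> (V - {0}) \<inter> {v. ?good v}" by blast
  qed blast
  have "open {v. ?good v}"
    unfolding f_minus by (intro open_Collect_conj open_Collect_ex open_Collect_less continuous_intros)
  then have "openin (proj_topology V) T"
    unfolding openin_proj_topology pre by (auto simp: T_def proj_space_def openin_open_Int)
  moreover have "T \<inter> region S = {}"
  proof -
    have False if u: "u \<in> V - {0}" "?good u" "span {u} \<in> region S" for u
    proof -
      have "u \<in> sign_cone S \<or> - u \<in> sign_cone S"
        using u span_in_region_iff by blast
      then show False
        using u(2) by (force simp: sign_cone_def agrees_def dest: less_asym)
    qed
    then show ?thesis unfolding T_def by blast
  qed
  moreover have "hyperplane V f j \<subseteq> T"
  proof
    fix L assume L: "L \<in> hyperplane V f j"
    then obtain v where v: "v \<in> V" "v \<noteq> 0" "L = span {v}"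
      by (auto simp: hyperplane_def proj_space_def)
    then have "f j v = 0"
      using L span_in_hyperplane_iff by blast
    moreover have "- v \<in> V" "- v \<noteq> 0"
      using v V by (auto simp: subspace_neg)
    ultimately have "\<not> weakly_agrees S v" "\<not> weakly_agrees S (- v)"
      using no v f_minus[of j v] by (blast, metis neg_equal_zero minus_zero)
    then have "?good v"
      by (simp add: weakly_agrees_def not_le)
    with v show "L \<in> T" unfolding T_def by blast
  qed
  ultimately show "proj_topology V closure_of region S \<inter> hyperplane V f j = {}"
    using openin_Int_closure_of_eq_empty[of "proj_topology V" T "region S"] by blast
qed

text \<open>Domains may be counted by patterns because a nonempty region determines its pattern once
  \<open>p \<in> S\<close> is imposed.\<close>

lemma num_bounded_domains_eq:
  "num_bounded_domains V f j = card {S. p \<in> S \<and> sign_cone S \<noteq> {} \<and>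
     \<not> (\<exists>v\<in>V. v \<noteq> 0 \<and> f j v = 0 \<and> weakly_agrees S v)}"
proof -
  let ?B = "{S. p \<in> S \<and> sign_cone S \<noteq> {} \<and> \<not> (\<exists>v\<in>V. v \<noteq> 0 \<and> f j v = 0 \<and> weakly_agrees S v)}"
  have "bounded_domains V f j = region ` {S \<in> {S. p \<in> S \<and> sign_cone S \<noteq> {}}.
      proj_topology V closure_of region S \<inter> hyperplane V f j = {}}"
    unfolding bounded_domains_def domains_eq[of p] by blast
  also have "\<dots> = region ` ?B"
    by (intro arg_cong[where f = "image region"] Collect_cong)
      (simp only: mem_Collect_eq conj_assoc closure_of_region_meets_hyperplane_iff
        simp_thms cong: conj_cong)
  finally have "bounded_domains V f j = region ` ?B" .
  moreover have "inj_on region ?B"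
  proof (rule inj_onI)
    fix S T assume "S \<in> ?B" "T \<in> ?B" "region S = region T"
    then show "S = T"
      using region_disjoint[of p S T] by (auto simp: region_def)
  qed
  ultimately show ?thesis
    by (simp add: num_bounded_domains_def card_image)
qed

end

section \<open>Bounded domains as sign sets\<close>

text \<open>The two vectors exclude each other, since their inner product would be a sum of
  nonnegative terms, one of them positive. Existence is Gordan's alternative for the complement of
  \<open>U\<close>, whose certificate lies in the double complement \<open>U\<close> and vanishes at
  \<open>j\<close>.\<close>

lemma stiemke:
  fixes U :: "(real ^ 'j::finite) set"
  assumes U: "subspace U"
  shows "(\<exists>y\<in>orthogonal_comp U. agrees S (UNIV - {j}) (($) y)) \<longleftrightarrow>
    \<not> (\<exists>x\<in>U. x \<noteq> 0 \<and> x $ j = 0 \<and> (\<forall>a. 0 \<le> sign_of S a * x $ a))"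
proof
  assume "\<exists>y\<in>orthogonal_comp U. agrees S (UNIV - {j}) (($) y)"
  then obtain y where y: "y \<in> orthogonal_comp U" "agrees S (UNIV - {j}) (($) y)" by blast
  show "\<not> (\<exists>x\<in>U. x \<noteq> 0 \<and> x $ j = 0 \<and> (\<forall>a. 0 \<le> sign_of S a * x $ a))"
  proof
    assume "\<exists>x\<in>U. x \<noteq> 0 \<and> x $ j = 0 \<and> (\<forall>a. 0 \<le> sign_of S a * x $ a)"
    then obtain x where x: "x \<in> U" "x \<noteq> 0" "x $ j = 0" "\<And>a. 0 \<le> sign_of S a * x $ a" by blast
    then obtain b where b: "x $ b \<noteq> 0" by (auto simp: vec_eq_iff)
    have nonneg: "0 \<le> x $ a * y $ a" for a
    proof (cases "a = j")
      case False
      then have "0 < sign_of S a * y $ a"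
        using y(2) by (simp add: agrees_def)
      with x(4)[of a] have "0 \<le> (sign_of S a * x $ a) * (sign_of S a * y $ a)"
        by (metis mult_nonneg_nonneg less_imp_le)
      then show ?thesis by (simp only: sign_of_mult_cancel)
    qed (simp add: x(3))
    have "b \<noteq> j" using b x(3) by blast
    then have "y $ b \<noteq> 0"
      using agrees_nonzero[OF y(2), of b] by simp
    with b nonneg[of b] have "0 < x $ b * y $ b"
      by (simp add: order_less_le)
    then have "0 < (\<Sum>a\<in>UNIV. x $ a * y $ a)"
      using nonneg by (intro sum_pos2[of UNIV b]) auto
    then show False
      using orthogonal_compD[OF x(1) y(1)] by (simp add: inner_vec_def)
  qed
next
  assume no: "\<not> (\<exists>x\<in>U. x \<noteq> 0 \<and> x $ j = 0 \<and> (\<forall>a. 0 \<le> sign_of S a * x $ a))"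
  show "\<exists>y\<in>orthogonal_comp U. agrees S (UNIV - {j}) (($) y)"
  proof (rule ccontr)
    assume "\<not> (\<exists>y\<in>orthogonal_comp U. agrees S (UNIV - {j}) (($) y))"
    then have "\<not> (\<exists>y\<in>orthogonal_comp U. (\<forall>a\<in>{}. y $ a = 0) \<and> agrees S (UNIV - {j}) (($) y))"
      by blast
    then obtain x where x: "x \<in> orthogonal_comp (orthogonal_comp U)"
      "\<And>a. a \<in> UNIV - {j} \<Longrightarrow> 0 \<le> sign_of S a * x $ a"
      "\<exists>a\<in>UNIV - {j}. x $ a \<noteq> 0" "\<And>a. a \<notin> (UNIV - {j}) \<union> {} \<Longrightarrow> x $ a = 0"
      using gordan[OF subspace_orthogonal_comp, of "UNIV - {j}" "{}" U S] by (metis Int_empty_right)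
    have "x \<in> U"
      using x(1) by (simp add: orthogonal_comp_self[OF U])
    moreover have "x \<noteq> 0"
      using x(3) by auto
    moreover have xj: "x $ j = 0"
      using x(4)[of j] by simp
    moreover have "0 \<le> sign_of S a * x $ a" for a
      using x(2)[of a] xj by (cases "a = j") auto
    ultimately show False
      using no by blast
  qed
qed

text \<open>The map \<open>g\<close> parametrises the space so that \<open>f\<close> becomes the
  family of coordinates, which also forces \<open>g\<close> to be injective. Then
  \<open>stiemke\<close> replaces boundedness by the existence of a dual vector.\<close>

lemma num_bounded_domains_eq_card_sign_sets:
  fixes U :: "(real ^ 'j::finite) set" and g :: "real ^ 'j \<Rightarrow> 'a::real_normed_vector"
  assumes U: "subspace U" and g: "linear g"
    and f: "\<And>a. bounded_linear (f a)" and fg: "\<And>a u. f a (g u) = u $ a"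
  shows "num_bounded_domains (g ` U) f j = card (sign_sets U p j {} {} UNIV)"
proof -
  interpret arrangement "g ` U" f
    by (rule arrangement.intro[OF linear_subspace_image[OF g U] f])
  have "g u = 0 \<longleftrightarrow> u = 0" for u
  proof
    assume "g u = 0"
    then have "u $ a = 0" for a
      using fg[of a u] by (simp add: linear_simps(3)[OF f])
    then show "u = 0" by (simp add: vec_eq_iff)
  qed (use linear_0[OF g] in simp)
  then have "(\<exists>v\<in>g ` U. v \<noteq> 0 \<and> f j v = 0 \<and> weakly_agrees S v) \<longleftrightarrow>
      (\<exists>x\<in>U. x \<noteq> 0 \<and> x $ j = 0 \<and> (\<forall>a. 0 \<le> sign_of S a * x $ a))" for S
    by (simp add: weakly_agrees_def fg)
  moreover have "sign_cone S \<noteq> {} \<longleftrightarrow> (\<exists>x\<in>U. agrees S UNIV (($) x))" for S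
    by (auto simp: sign_cone_def fg)
  ultimately have "{S. p \<in> S \<and> sign_cone S \<noteq> {} \<and> \<not> (\<exists>v\<in>g ` U. v \<noteq> 0 \<and> f j v = 0 \<and> weakly_agrees S v)} =
      sign_sets U p j {} {} UNIV"
    unfolding sign_sets_def using stiemke[OF U, of _ j] by simp
  then show ?thesis
    using num_bounded_domains_eq[of j p] by simp
qed

section \<open>Duality by changing one sign\<close>

definition flip :: "'j \<Rightarrow> 'j set \<Rightarrow> 'j set" where
  "flip j S = (if j \<in> S then S - {j} else insert j S)"

lemma flip_flip [simp]: "flip j (flip j S) = S"
  by (auto simp: flip_def)

lemma mem_flip_iff: "a \<in> flip j S \<longleftrightarrow> (if a = j then a \<notin> S else a \<in> S)"
  by (auto simp: flip_def)

lemma sign_of_flip: "sign_of (flip j S) a = (if a = j then - sign_of S a else sign_of S a)"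
  unfolding sign_of_def mem_flip_iff by (cases "a = j"; cases "a \<in> S"; simp)

text \<open>The vectors \<open>x\<close> and \<open>y\<close> exchange roles: orthogonality gives
  \<open>y\<close> the sign opposite to \<open>S\<close> at \<open>j\<close>, so \<open>y\<close>
  realises the flipped pattern everywhere, while \<open>x\<close> still has it off
  \<open>j\<close>.\<close>

lemma flip_in_sign_sets:
  fixes W :: "(real ^ 'j::finite) set"
  assumes W: "subspace W" and p: "p \<noteq> j" and S: "S \<in> sign_sets W p j {} {} UNIV"
  shows "flip j S \<in> sign_sets (orthogonal_comp W) p j {} {} UNIV"
proof -
  obtain x y where x: "x \<in> W" "agrees S UNIV (($) x)"
    and y: "y \<in> orthogonal_comp W" "agrees S (UNIV - {j}) (($) y)"
    using S by (auto simp: sign_sets_def)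
  have pos: "0 < x $ a * y $ a" if "a \<noteq> j" for a
    using x(2) y(2) that sign_of_mult_pos_iff[of S a "x $ a" "y $ a"] by (simp add: agrees_def)
  \<comment> \<open>The index \<open>p\<close> makes the range of summation nonempty, which strict
    positivity requires.\<close>
  have "0 < (\<Sum>a\<in>UNIV - {j}. x $ a * y $ a)"
    using pos p by (intro sum_pos) auto
  moreover have "0 = x $ j * y $ j + (\<Sum>a\<in>UNIV - {j}. x $ a * y $ a)"
    using inner_eq_sum_plus[of j "UNIV - {j}" x y] orthogonal_compD[OF x(1) y(1)] by auto
  ultimately have "0 < x $ j * - y $ j" by simp
  then have "0 < sign_of S j * - y $ j"
    using x(2) sign_of_mult_pos_iff[of S j "x $ j" "- y $ j"] by (simp add: agrees_def)
  then have "agrees (flip j S) UNIV (($) y)"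
    using y(2) by (auto simp: agrees_def sign_of_flip)
  moreover have "agrees (flip j S) (UNIV - {j}) (($) x)"
    using x(2) by (auto simp: agrees_def sign_of_flip)
  moreover have "p \<in> flip j S"
    using S p by (auto simp: sign_sets_def flip_def)
  ultimately show ?thesis
    using x(1) y(1) by (auto simp: sign_sets_def orthogonal_comp_self[OF W])
qed

lemma card_sign_sets_orthogonal_comp:
  fixes W :: "(real ^ 'j::finite) set"
  assumes W: "subspace W" and p: "p \<noteq> j"
  shows "card (sign_sets W p j {} {} UNIV) = card (sign_sets (orthogonal_comp W) p j {} {} UNIV)"
proof (rule bij_betw_same_card)
  show "bij_betw (flip j) (sign_sets W p j {} {} UNIV) (sign_sets (orthogonal_comp W) p j {} {} UNIV)"
    using flip_in_sign_sets[OF W p] flip_in_sign_sets[OF subspace_orthogonal_comp p, of _ W]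
    by (intro bij_betwI[where g = "flip j"]) (auto simp: orthogonal_comp_self[OF W])
qed

section \<open>The annihilator and the conclusion\<close>

lemma annihilator_eq:
  fixes W :: "(real ^ 'j::finite) set"
  shows "annihilator W = blinfun_inner_right ` orthogonal_comp W"
proof (intro equalityI subsetI)
  fix \<phi> assume \<phi>: "\<phi> \<in> annihilator W"
  \<comment> \<open>This is the Riesz representative of the functional.\<close>
  define y where "y = adjoint (blinfun_apply \<phi>) 1"
  have y: "blinfun_apply \<phi> x = y \<bullet> x" for x
    using adjoint_works[OF bounded_linear.linear[OF blinfun.bounded_linear_right[of \<phi>]], of x 1]
    by (simp add: y_def inner_commute)
  then have "\<phi> = blinfun_inner_right y"
    by (intro blinfun_eqI) simp
  moreover have "y \<in> orthogonal_comp W"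
    using \<phi> y by (simp add: annihilator_def orthogonal_comp_def orthogonal_def inner_commute)
  ultimately show "\<phi> \<in> blinfun_inner_right ` orthogonal_comp W" by blast
qed (auto simp: annihilator_def orthogonal_comp_def orthogonal_def inner_commute)

theorem lemma3p10:
  fixes N k n :: nat
    and W :: "(real ^ 'j::finite) set"
    and W' :: "((real ^ 'j) \<Rightarrow>\<^sub>L real) set"
    and i j :: 'j
  assumes "N \<ge> 3"
    and "k + n + 1 = N"
    and "1 \<le> k" and "k \<le> N - 2"
    and "1 \<le> n" and "n \<le> N - 2"
    and "CARD('j) = N + 1"
    and "dual_admissible_pairs k W W'"
  shows "num_bounded_domains W dual_basis i = num_bounded_domains W' std_basis j"
proof -
  have W: "subspace W" and W': "W' = blinfun_inner_right ` orthogonal_comp W"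
    using assms(8) by (auto simp: dual_admissible_pairs_def annihilator_eq)
  have "\<exists>p::'j. p \<noteq> j"
  proof (rule ccontr)
    assume "\<not> (\<exists>p. p \<noteq> j)"
    then have "(UNIV :: 'j set) = {j}" by auto
    then have "CARD('j) = card {j}" by (rule arg_cong)
    then show False
      using assms(1,7) by simp
  qed
  then obtain p where p: "p \<noteq> j" by blast
  \<comment> \<open>The selector \<open>q\<close> is arbitrary here, so the count is the same for
    every selector. This permits the passage from \<open>i\<close>, used for independence, to
    \<open>p\<close>, which differs from \<open>j\<close> as the sign change demands.\<close>
  have primal: "num_bounded_domains W dual_basis b = card (sign_sets W q b {} {} UNIV)" for q b
    using num_bounded_domains_eq_card_sign_sets[OF W linear_id, of dual_basis b q]
    by (simp add: dual_basis_def[abs_def] bounded_linear_vec_nth)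
  have dual: "num_bounded_domains W' std_basis j = card (sign_sets (orthogonal_comp W) p j {} {} UNIV)"
    unfolding W'
    by (rule num_bounded_domains_eq_card_sign_sets[OF subspace_orthogonal_comp])
      (auto simp: std_basis_def[abs_def] inner_axis
        intro: bounded_linear.linear[OF bounded_linear_blinfun_inner_right] blinfun.bounded_linear_left)
  have "num_bounded_domains W dual_basis i = card (sign_sets W i i {} {} UNIV)"
    by (rule primal)
  also have "\<dots> = card (sign_sets W i j {} {} UNIV)"
    by (rule card_sign_sets_independent[OF W]) auto
  also have "\<dots> = card (sign_sets W p j {} {} UNIV)"
    using primal[of j] by metis
  also have "\<dots> = num_bounded_domains W' std_basis j"
    using card_sign_sets_orthogonal_comp[OF W p] dual by simp
  finally show ?thesis .
qed

end
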